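(* Let $\Delta\geq 1$ be an integer and let $G$ be a graph with maximum degree $\Delta$. Let $$\beta:=(1+2^{1/3}\Delta^{-1/3})(\Delta-1)^2\quad\text{and}\quad c:=\left\lceil \beta+2^{-2/3}\Delta^{5/3}(1+2^{1/3}\Delta^{-1/3})^2\right\rceil.$$ Then $G$ is nonrepetitively $c$-choosable. Moreover, for every $c$-list-assignment $L$ of $G$ there are at least $\beta^{|V(G)|}$ nonrepetitive $L$-colourings of $G$.
   Context: Graphs are finite and simple. For a colouring $\phi$ of a graph $G$, a path $(v_1,\dots,v_{2t})$ in $G$ (with $t\geq 1$) is repetitively coloured if $\phi(v_i)=\phi(v_{t+i})$ for each $i\in\{1,\dots,t\}$. A colouring is nonrepetitive if no path of $G$ is repetitively coloured. A list-assignment $L$ assigns each vertex $v$ a set $L(v)$ of colours; it is a $c$-list-assignment if $|L(v)|=c$ for all $v$; an $L$-colouring is a colouring $\phi$ with $\phi(v)\in L(v)$ for all $v$. $G$ is nonrepetitively $c$-choosable if it has a nonrepetitive $L$-colouring for every $c$-list-assignment $L$. *)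

theory Defs
  imports
    Complex_Main
    "HOL-Library.FuncSet"
    "Graph_Theory.Digraph"
    "Graph_Theory.Vertex_Walk"
begin

text \<open>
  A finite simple graph is a term satisfying the predicate \<open>graph\<close> of the entry Graph-Theory:
  a finite loop-free symmetric digraph without parallel arcs. Each edge is a pair of opposite
  arcs, so the degree of a vertex is its out-degree, and a path is a \<open>vpath\<close>, i.e. a nonempty
  list of distinct vertices in which consecutive ones are adjacent.
\<close>

text \<open>The \<open>insert 0\<close> only matters for the graph without vertices.\<close>
definition max_degree :: "('a, 'b) pre_digraph \<Rightarrow> nat" where
  "max_degree G = Max (insert 0 (out_degree G ` verts G))"

definition repetitively_coloured :: "('a \<Rightarrow> 'c) \<Rightarrow> 'a list \<Rightarrow> bool" where
  "repetitively_coloured \<phi> p \<longleftrightarrow>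
     (\<exists>t\<ge>1. length p = 2 * t \<and> (\<forall>i<t. \<phi> (p ! i) = \<phi> (p ! (t + i))))"

definition nonrepetitive :: "('a, 'b) pre_digraph \<Rightarrow> ('a \<Rightarrow> 'c) \<Rightarrow> bool" where
  "nonrepetitive G \<phi> \<longleftrightarrow> (\<forall>p. vpath p G \<longrightarrow> \<not> repetitively_coloured \<phi> p)"

definition list_assignment :: "('a, 'b) pre_digraph \<Rightarrow> nat \<Rightarrow> ('a \<Rightarrow> 'c set) \<Rightarrow> bool" where
  "list_assignment G c L \<longleftrightarrow> (\<forall>v\<in>verts G. finite (L v) \<and> card (L v) = c)"

text \<open>
  Colourings are extensional functions on the vertex set (\<open>undefined\<close> elsewhere), so that the
  cardinality of this set counts each colouring of \<open>G\<close> exactly once.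
\<close>
definition nonrepetitive_list_colourings ::
    "('a, 'b) pre_digraph \<Rightarrow> ('a \<Rightarrow> 'c set) \<Rightarrow> ('a \<Rightarrow> 'c) set" where
  "nonrepetitive_list_colourings G L = {\<phi> \<in> Pi\<^sub>E (verts G) L. nonrepetitive G \<phi>}"

text \<open>
  HOL cannot quantify over types inside a formula, so the type of colours is an explicit
  parameter; choosability means that this holds for every type \<open>'c\<close>.
\<close>
definition nonrepetitively_choosable ::
    "'c itself \<Rightarrow> ('a, 'b) pre_digraph \<Rightarrow> nat \<Rightarrow> bool" where
  "nonrepetitively_choosable _ G c \<longleftrightarrow>
     (\<forall>L :: 'a \<Rightarrow> 'c set. list_assignment G c L \<longrightarrow> nonrepetitive_list_colourings G L \<noteq> {})"

end

theory Submission
  imports Defs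
begin

text \<open>
  The counting argument of Rosenfeld and Wood: deleting a vertex \<open>v\<close> from an induced subgraph
  divides the number of nonrepetitive colourings by at least \<open>\<beta>\<close>. Extend the colourings of
  \<open>S - {v}\<close> to \<open>v\<close> in all \<open>c\<close> ways. In a bad extension some path \<open>p\<close> on \<open>2t\<close> vertices through \<open>v\<close>
  is repetitive, and the half \<open>A\<close> of \<open>p\<close> containing \<open>v\<close> is determined by the other half. So \<open>p\<close> spoils
  at most as many extensions as there are colourings of \<open>S - A\<close>, which by induction is at most
  \<open>\<beta>\<^bsup>1-t\<^esup>\<close> times the number for \<open>S - {v}\<close>. There are at most \<open>t\<Delta>(\<Delta>-1)\<^bsup>2t-2\<^esup>\<close> such paths, and
  summing over \<open>t\<close> gives \<open>\<Delta> / (1 - x)\<^sup>2\<close> with \<open>x = (\<Delta>-1)\<^sup>2/\<beta>\<close>.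
\<close>

section \<open>Counting paths\<close>

text \<open>Fixing the position \<open>i\<close> of \<open>v\<close> lets paths be counted by adding
  vertices at the end. A path and its reversal are two different lists.\<close>

definition paths_at :: "('a, 'b) pre_digraph \<Rightarrow> nat \<Rightarrow> nat \<Rightarrow> 'a \<Rightarrow> 'a list set" where
  "paths_at G n i v = {p. vpath p G \<and> length p = n \<and> p ! i = v}"

lemma vpath_rev:
  assumes "graph G" "vpath p G"
  shows "vpath (rev p) G"
proof -
  interpret graph G by fact
  show ?thesis
    using assms(2) arcs_ends_symmetric[OF sym_arcs]
    by (auto simp: vpath_def vwalk_def set_vwalk_arcs_rev)
qed

lemma vpath_snocD:
  assumes "vpath (q @ [w]) G" "q \<noteq> []"
  shows "vpath q G" "(last q, w) \<in> arcs_ends G" "w \<notin> set q"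
  using assms by (auto simp: vpath_def vwalk_def vwalk_arcs_append)

lemma vpath_snoc_snocD:
  assumes "vpath (q @ [u, w]) G"
  shows "(u, w) \<in> arcs_ends G"
  using vpath_snocD(2)[of "q @ [u]" w G] assms by simp

lemma finite_paths_at:
  assumes "finite (verts G)"
  shows "finite (paths_at G n i v)"
proof -
  have "paths_at G n i v \<subseteq> {p. set p \<subseteq> verts G \<and> length p = n}"
    by (auto simp: paths_at_def vpath_def vwalk_def)
  then show ?thesis
    using finite_lists_length_eq[OF assms] finite_subset by blast
qed

lemma card_neighbours_le:
  assumes "graph G" "\<And>u. u \<in> verts G \<Longrightarrow> out_degree G u \<le> D"
  shows "finite {w. (u, w) \<in> arcs_ends G}" "card {w. (u, w) \<in> arcs_ends G} \<le> D"
proof -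
  interpret graph G by fact
  have eq: "{w. (u, w) \<in> arcs_ends G} = head G ` out_arcs G u"
    by (auto simp: arcs_ends_conv)
  show "finite {w. (u, w) \<in> arcs_ends G}"
    unfolding eq by (intro finite_imageI finite_out_arcs)
  show "card {w. (u, w) \<in> arcs_ends G} \<le> D"
  proof (cases "u \<in> verts G")
    case True
    have "card (head G ` out_arcs G u) \<le> card (out_arcs G u)"
      by (intro card_image_le finite_out_arcs)
    then show ?thesis
      unfolding eq using assms(2)[OF True] by (simp add: out_degree_def)
  next
    case False
    then have "{w. (u, w) \<in> arcs_ends G} = {}"
      using adj_in_verts by blast
    then show ?thesis by (metis card.empty le0)
  qed
qed

lemma card_paths_at_rev:
  assumes "graph G" "i < n"
  shows "card (paths_at G n i v) \<le> card (paths_at G n (n - Suc i) v)"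
proof -
  interpret graph G by fact
  have "rev ` paths_at G n i v \<subseteq> paths_at G n (n - Suc i) v"
    using assms by (auto simp: paths_at_def vpath_rev rev_nth)
  then have "card (rev ` paths_at G n i v) \<le> card (paths_at G n (n - Suc i) v)"
    by (intro card_mono finite_paths_at finite_verts)
  then show ?thesis
    by (simp add: card_image)
qed

text \<open>The last vertex of a path on at least two vertices has its predecessor among its
  neighbours, which leaves at most \<open>D - 1\<close> continuations.\<close>

lemma card_paths_at_snoc:
  assumes "graph G" "\<And>u. u \<in> verts G \<Longrightarrow> out_degree G u \<le> D" "i < n" "2 \<le> n"
  shows "card (paths_at G (Suc n) i v) \<le> card (paths_at G n i v) * (D - 1)"
proof -
  interpret graph G by fact
  \<comment> \<open>\<open>last (butlast q)\<close> is the predecessor of the last vertex.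
    \<open>W q\<close> may still contain earlier vertices of \<open>q\<close>, which is harmless for
    an upper bound.\<close>
  define W where "W q = {w. (last q, w) \<in> arcs_ends G} - {last (butlast q)}" for q :: "'a list"
  have fin: "finite (paths_at G n i v)"
    by (intro finite_paths_at finite_verts)
  have finW: "finite (W q)" for q
    unfolding W_def using card_neighbours_le(1)[OF assms(1,2)] by auto
  have cW: "card (W q) \<le> D - 1" if "q \<in> paths_at G n i v" for q
  proof -
    have q: "vpath q G" "length q = n"
      using that by (auto simp: paths_at_def)
    then have ne: "q \<noteq> []" "butlast q \<noteq> []"
      using assms(4) by (auto simp flip: length_greater_0_conv)
    have "q = butlast (butlast q) @ [last (butlast q), last q]"
      using ne by (metis append.assoc append_Cons append_Nil append_butlast_last_id)
    then have "(last (butlast q), last q) \<in> arcs_ends G"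
      using q vpath_snoc_snocD by metis
    \<comment> \<open>Adjacency is symmetric, so the predecessor is itself a neighbour and removing
      it lowers the count by one.\<close>
    then have "last (butlast q) \<in> {w. (last q, w) \<in> arcs_ends G}"
      using arcs_ends_symmetric[OF sym_arcs] by auto
    then show ?thesis
      unfolding W_def using card_neighbours_le[OF assms(1,2), of "last q"]
      by (simp add: card_Diff_singleton)
  qed
  have "paths_at G (Suc n) i v \<subseteq> (\<lambda>(q, w). q @ [w]) ` (SIGMA q:paths_at G n i v. W q)"
  proof
    fix p assume "p \<in> paths_at G (Suc n) i v"
    then have p: "vpath p G" "length p = Suc n" "p ! i = v"
      by (auto simp: paths_at_def)
    then obtain q w where pq: "p = q @ [w]" "length q = n"
      by (metis length_append_singleton length_Suc_conv_rev)
    then have ne: "q \<noteq> []" "butlast q \<noteq> []"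
      using assms(4) by (auto simp flip: length_greater_0_conv)
    have "last (butlast q) \<in> set q"
      using ne by (meson in_set_butlastD last_in_set)
    then have "q \<in> paths_at G n i v" "w \<in> W q"
      using vpath_snocD[OF p(1)[unfolded pq(1)] ne(1)] p pq assms(3)
      by (auto simp: paths_at_def W_def nth_append)
    then show "p \<in> (\<lambda>(q, w). q @ [w]) ` (SIGMA q:paths_at G n i v. W q)"
      using pq by force
  qed
  then have "card (paths_at G (Suc n) i v) \<le> card (SIGMA q:paths_at G n i v. W q)"
    using fin finW by (intro surj_card_le) auto
  also have "\<dots> = (\<Sum>q\<in>paths_at G n i v. card (W q))"
    using fin finW by (intro card_SigmaI) auto
  also have "\<dots> \<le> (\<Sum>q\<in>paths_at G n i v. D - 1)"
    by (intro sum_mono cW)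
  finally show ?thesis by simp
qed

lemma card_paths_at_two:
  assumes "graph G" "\<And>u. u \<in> verts G \<Longrightarrow> out_degree G u \<le> D"
  shows "card (paths_at G 2 0 v) \<le> D"
proof -
  have "paths_at G 2 0 v \<subseteq> (\<lambda>w. [v, w]) ` {w. (v, w) \<in> arcs_ends G}"
  proof
    fix p assume "p \<in> paths_at G 2 0 v"
    then obtain w where "p = [v, w]" "vpath [v, w] G"
      by (auto simp: paths_at_def length_Suc_conv numeral_2_eq_2)
    then show "p \<in> (\<lambda>w. [v, w]) ` {w. (v, w) \<in> arcs_ends G}"
      by (auto simp: vpath_def vwalk_def)
  qed
  then have "card (paths_at G 2 0 v) \<le> card {w. (v, w) \<in> arcs_ends G}"
    using card_neighbours_le(1)[OF assms] by (intro surj_card_le) auto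
  then show ?thesis
    using card_neighbours_le(2)[OF assms, of v] by linarith
qed

text \<open>Start from an edge at \<open>v\<close>, with at most \<open>D\<close> choices, and
  lengthen it at either end; each further vertex has at most \<open>D - 1\<close> choices.\<close>

lemma card_paths_at_le:
  assumes "graph G" "\<And>u. u \<in> verts G \<Longrightarrow> out_degree G u \<le> D" "i < n" "2 \<le> n"
  shows "card (paths_at G n i v) \<le> D * (D - 1) ^ (n - 2)"
  using assms(4,3)
proof (induction n arbitrary: i rule: dec_induct)
  case base
  then consider "i = 0" | "i = 1" by linarith
  then have "card (paths_at G 2 i v) \<le> card (paths_at G 2 0 v)"
    using card_paths_at_rev[OF assms(1), of i 2 v] by cases auto
  then show ?case
    using card_paths_at_two[OF assms(1,2), of v] by simp
next
  case (step n)
  have *: "card (paths_at G (Suc n) j v) \<le> D * (D - 1) ^ (Suc n - 2)" if "j < n" for j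
  proof -
    have "card (paths_at G (Suc n) j v) \<le> card (paths_at G n j v) * (D - 1)"
      using step that by (intro card_paths_at_snoc[OF assms(1,2)]) auto
    also have "\<dots> \<le> D * (D - 1) ^ (n - 2) * (D - 1)"
      by (intro mult_right_mono step.IH that) simp
    also have "\<dots> = D * (D - 1) ^ (Suc n - 2)"
    proof -
      have "Suc n - 2 = Suc (n - 2)" using step(1) by simp
      then show ?thesis by simp
    qed
    finally show ?thesis .
  qed
  show ?case
  proof (cases "i < n")
    case False
    \<comment> \<open>Cutting off the last vertex would cut off \<open>v\<close> itself, so the path
      is first reversed to bring \<open>v\<close> to position 0.\<close>
    then have "i = n" using step.prems by simp
    then show ?thesis
      using card_paths_at_rev[OF assms(1), of n "Suc n" v] *[of 0] step(1) by simp
  qed (rule *)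
qed

section \<open>Colourings of induced subgraphs\<close>

text \<open>These are the nonrepetitive \<open>L\<close>-colourings of the subgraph induced by
  \<open>S\<close>, whose paths are the paths of \<open>G\<close> inside \<open>S\<close>.\<close>

definition colourings_on :: "('a, 'b) pre_digraph \<Rightarrow> ('a \<Rightarrow> 'c set) \<Rightarrow> 'a set \<Rightarrow> ('a \<Rightarrow> 'c) set" where
  "colourings_on G L S = {\<phi> \<in> Pi\<^sub>E S L.
     \<forall>p. vpath p G \<longrightarrow> set p \<subseteq> S \<longrightarrow> \<not> repetitively_coloured \<phi> p}"

lemma repetitively_coloured_cong:
  assumes "\<And>u. u \<in> set p \<Longrightarrow> \<phi> u = \<psi> u"
  shows "repetitively_coloured \<phi> p \<longleftrightarrow> repetitively_coloured \<psi> p"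
  unfolding repetitively_coloured_def using assms
  by (intro ex_cong1 conj_cong refl all_cong1 imp_cong) auto

lemma repetitively_coloured_rev:
  assumes "repetitively_coloured \<phi> p"
  shows "repetitively_coloured \<phi> (rev p)"
proof -
  obtain t where t: "t \<ge> 1" "length p = 2 * t" "\<And>i. i < t \<Longrightarrow> \<phi> (p ! i) = \<phi> (p ! (t + i))"
    using assms by (auto simp: repetitively_coloured_def)
  \<comment> \<open>The \<open>i\<close>-th pair of matched positions of \<open>rev p\<close> is the
    pair of \<open>p\<close> with index \<open>t - Suc i\<close>, swapped.\<close>
  have "\<phi> (rev p ! i) = \<phi> (rev p ! (t + i))" if "i < t" for i
    using t(3)[of "t - Suc i"] that t(2) by (simp add: rev_nth mult_2)
  then show ?thesis
    using t(1,2) by (auto simp: repetitively_coloured_def)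
qed

lemma colourings_on_verts: "colourings_on G L (verts G) = nonrepetitive_list_colourings G L"
  unfolding colourings_on_def nonrepetitive_list_colourings_def nonrepetitive_def
  by (auto simp: vpath_def vwalk_def)

lemma colourings_on_empty: "colourings_on G L {} = {\<lambda>_. undefined}"
  by (auto simp: colourings_on_def vpath_def vwalk_def)

lemma restrict_colourings_on:
  assumes "\<phi> \<in> colourings_on G L S" "T \<subseteq> S"
  shows "restrict \<phi> T \<in> colourings_on G L T"
proof -
  have "\<not> repetitively_coloured (restrict \<phi> T) p" if "vpath p G" "set p \<subseteq> T" for p
  proof -
    have "repetitively_coloured (restrict \<phi> T) p \<longleftrightarrow> repetitively_coloured \<phi> p"
      using that by (intro repetitively_coloured_cong) auto
    then show ?thesis
      using assms that by (auto simp: colourings_on_def)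
  qed
  then show ?thesis
    using assms by (auto simp: colourings_on_def)
qed

lemma finite_colourings_on:
  assumes "finite S" "\<And>u. u \<in> S \<Longrightarrow> finite (L u)"
  shows "finite (colourings_on G L S)"
  using finite_PiE[OF assms] by (rule rev_finite_subset) (auto simp: colourings_on_def)

section \<open>Extending colourings to one further vertex\<close>

definition extensions :: "('a, 'b) pre_digraph \<Rightarrow> ('a \<Rightarrow> 'c set) \<Rightarrow> 'a set \<Rightarrow> 'a \<Rightarrow> ('a \<Rightarrow> 'c) set" where
  "extensions G L S v = {\<phi> \<in> Pi\<^sub>E S L. restrict \<phi> (S - {v}) \<in> colourings_on G L (S - {v})}"

lemma finite_extensions:
  assumes "finite S" "\<And>u. u \<in> S \<Longrightarrow> finite (L u)"
  shows "finite (extensions G L S v)"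
  using finite_PiE[OF assms] by (rule rev_finite_subset) (auto simp: extensions_def)

text \<open>The colour at \<open>v\<close> is chosen freely from \<open>L v\<close>, independently
  of the colouring of \<open>S - {v}\<close>.\<close>

lemma card_extensions:
  assumes "v \<in> S"
  shows "card (extensions G L S v) = card (L v) * card (colourings_on G L (S - {v}))"
proof -
  have "bij_betw (\<lambda>\<phi>. (\<phi> v, restrict \<phi> (S - {v}))) (extensions G L S v)
    (L v \<times> colourings_on G L (S - {v}))"
  proof (rule bij_betw_byWitness[where f' = "\<lambda>(x, \<psi>). \<psi>(v := x)"])
    show "\<forall>\<phi>\<in>extensions G L S v. (\<lambda>(x, \<psi>). \<psi>(v := x)) (\<phi> v, restrict \<phi> (S - {v})) = \<phi>"
      by (auto simp: extensions_def fun_eq_iff PiE_def extensional_def restrict_def)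
    \<comment> \<open>\<open>\<psi>\<close> is \<open>undefined\<close> at \<open>v\<close>, and
      restricting resets the updated value to exactly this default.\<close>
    have *: "restrict (\<psi>(v := x)) (S - {v}) = \<psi>" if "\<psi> \<in> colourings_on G L (S - {v})" for \<psi> x
      using that by (auto simp: colourings_on_def fun_eq_iff PiE_def extensional_def restrict_def)
    then show "\<forall>y\<in>L v \<times> colourings_on G L (S - {v}).
        (\<lambda>\<phi>. (\<phi> v, restrict \<phi> (S - {v}))) ((\<lambda>(x, \<psi>). \<psi>(v := x)) y) = y"
      by auto
    show "(\<lambda>\<phi>. (\<phi> v, restrict \<phi> (S - {v}))) ` extensions G L S v
        \<subseteq> L v \<times> colourings_on G L (S - {v})"
      using assms by (auto simp: extensions_def)
    show "(\<lambda>(x, \<psi>). \<psi>(v := x)) ` (L v \<times> colourings_on G L (S - {v})) \<subseteq> extensions G L S v"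
    proof clarify
      fix x \<psi> assume x: "x \<in> L v" and \<psi>: "\<psi> \<in> colourings_on G L (S - {v})"
      have "\<psi>(v := x) \<in> Pi\<^sub>E (insert v (S - {v})) L"
        using x \<psi> by (intro PiE_fun_upd) (auto simp: colourings_on_def)
      then show "\<psi>(v := x) \<in> extensions G L S v"
        using \<psi> *[OF \<psi>] assms by (simp add: extensions_def insert_absorb)
    qed
  qed
  then show ?thesis
    by (simp add: bij_betw_same_card card_cartesian_product)
qed

text \<open>The first half of \<open>p\<close> is determined by the second, which survives in \<open>S - A\<close>.\<close>
lemma card_repetitive_extensions_le:
  assumes "finite S" "\<And>u. u \<in> S \<Longrightarrow> finite (L u)"
    and p: "vpath p G" "set p \<subseteq> S" "length p = 2 * t" "v \<in> set (take t p)"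
  shows "card {\<phi> \<in> extensions G L S v. \<forall>i<t. \<phi> (p ! i) = \<phi> (p ! (t + i))}
    \<le> card (colourings_on G L (S - set (take t p)))"
proof -
  let ?A = "set (take t p)"
  let ?B = "{\<phi> \<in> extensions G L S v. \<forall>i<t. \<phi> (p ! i) = \<phi> (p ! (t + i))}"
  have dp: "distinct p" using p(1) by (simp add: vpath_def)
  have second: "p ! (t + i) \<in> S - ?A" if "i < t" for i
  proof -
    have "p ! (t + i) \<in> set p"
      using that p(3) by simp
    moreover have "p ! (t + i) \<notin> ?A"
      using that dp p(3) by (auto simp: in_set_conv_nth nth_eq_iff_index_eq)
    ultimately show ?thesis
      using p(2) by auto
  qed
  have "inj_on (\<lambda>\<phi>. restrict \<phi> (S - ?A)) ?B"
  proof (rule inj_onI)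
    fix \<phi> \<psi> assume B: "\<phi> \<in> ?B" "\<psi> \<in> ?B"
      and eq: "restrict \<phi> (S - ?A) = restrict \<psi> (S - ?A)"
    have agree: "\<phi> u = \<psi> u" if "u \<in> S - ?A" for u
      using fun_cong[OF eq, of u] that by simp
    have "\<phi> u = \<psi> u" if "u \<in> S" for u
    proof (cases "u \<in> ?A")
      case True
      then obtain i where "i < t" "u = p ! i"
        by (auto simp: in_set_conv_nth)
      then show ?thesis
        using B agree[OF second] by auto
    qed (use that agree in auto)
    moreover have "\<phi> \<in> Pi\<^sub>E S L" "\<psi> \<in> Pi\<^sub>E S L"
      using B by (auto simp: extensions_def)
    ultimately show "\<phi> = \<psi>"
      by (intro PiE_ext)
  qed
  moreover have "(\<lambda>\<phi>. restrict \<phi> (S - ?A)) ` ?B \<subseteq> colourings_on G L (S - ?A)"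
  proof clarify
    fix \<phi> assume "\<phi> \<in> extensions G L S v"
    then have "restrict \<phi> (S - {v}) \<in> colourings_on G L (S - {v})"
      by (simp add: extensions_def)
    \<comment> \<open>\<open>\<phi>\<close> may have repetitive paths through \<open>v\<close>; but
      \<open>v\<close> lies in \<open>?A\<close>, so \<open>S - ?A\<close> is contained in
      \<open>S - {v}\<close>, where \<open>\<phi>\<close> has none.\<close>
    then have "restrict (restrict \<phi> (S - {v})) (S - ?A) \<in> colourings_on G L (S - ?A)"
      by (rule restrict_colourings_on) (use p(4) in auto)
    moreover have "(S - {v}) \<inter> (S - ?A) = S - ?A"
      using p(4) by auto
    ultimately show "restrict \<phi> (S - ?A) \<in> colourings_on G L (S - ?A)"
      by (simp add: Int_commute)
  qed
  ultimately show ?thesis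
    using finite_colourings_on[of "S - ?A" L G] assms(1,2) by (intro card_inj_on_le) auto
qed

section \<open>Paths with a given vertex in the first half\<close>

definition half_paths :: "('a, 'b) pre_digraph \<Rightarrow> 'a set \<Rightarrow> 'a \<Rightarrow> nat \<Rightarrow> 'a list set" where
  "half_paths G S v t = {p. vpath p G \<and> set p \<subseteq> S \<and> length p = 2 * t \<and> v \<in> set (take t p)}"

lemma half_paths_subset: "half_paths G S v t \<subseteq> (\<Union>i<t. paths_at G (2 * t) i v)"
  by (auto simp: half_paths_def paths_at_def in_set_conv_nth)

lemma finite_half_paths:
  assumes "finite (verts G)"
  shows "finite (half_paths G S v t)"
  using half_paths_subset by (rule finite_subset) (use finite_paths_at[OF assms] in auto)

text \<open>There are \<open>Suc s\<close> positions for \<open>v\<close> in the first half, and a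
  path on \<open>2 * Suc s\<close> vertices gives the exponent \<open>2 * s\<close>. Half lengths
  are written \<open>Suc s\<close> so that sums over them start at \<open>s = 0\<close>.\<close>

lemma card_half_paths_le:
  assumes "graph G" "\<And>u. u \<in> verts G \<Longrightarrow> out_degree G u \<le> D"
  shows "card (half_paths G S v (Suc s)) \<le> Suc s * (D * (D - 1) ^ (2 * s))"
proof -
  interpret graph G by fact
  have "card (half_paths G S v (Suc s)) \<le> card (\<Union>i<Suc s. paths_at G (2 * Suc s) i v)"
    using finite_paths_at[OF finite_verts] by (intro card_mono half_paths_subset) auto
  also have "\<dots> \<le> (\<Sum>i<Suc s. card (paths_at G (2 * Suc s) i v))"
    by (intro card_UN_le) simp
  also have "\<dots> \<le> (\<Sum>i<Suc s. D * (D - 1) ^ (2 * Suc s - 2))"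
    by (intro sum_mono card_paths_at_le[OF assms]) auto
  finally show ?thesis by simp
qed

text \<open>Reversing a repetitive path through \<open>v\<close> if necessary puts \<open>v\<close> in its first half.\<close>
lemma extensions_subset:
  assumes "graph G" "finite S" "v \<in> S"
  shows "extensions G L S v \<subseteq> colourings_on G L S \<union>
    (\<Union>s<card S. \<Union>p\<in>half_paths G S v (Suc s).
      {\<phi> \<in> extensions G L S v. \<forall>i<Suc s. \<phi> (p ! i) = \<phi> (p ! (Suc s + i))})"
proof
  fix \<phi> assume \<phi>: "\<phi> \<in> extensions G L S v"
  show "\<phi> \<in> colourings_on G L S \<union>
    (\<Union>s<card S. \<Union>p\<in>half_paths G S v (Suc s).
      {\<phi> \<in> extensions G L S v. \<forall>i<Suc s. \<phi> (p ! i) = \<phi> (p ! (Suc s + i))})"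
  proof (cases "\<phi> \<in> colourings_on G L S")
    case False
    then obtain p where p: "vpath p G" "set p \<subseteq> S" "repetitively_coloured \<phi> p"
      using \<phi> by (auto simp: colourings_on_def extensions_def)
    have "v \<in> set p"
    proof (rule ccontr)
      assume "v \<notin> set p"
      then have "repetitively_coloured (restrict \<phi> (S - {v})) p \<longleftrightarrow> repetitively_coloured \<phi> p"
        using p by (intro repetitively_coloured_cong) auto
      then show False
        using \<phi> p \<open>v \<notin> set p\<close> by (auto simp: extensions_def colourings_on_def)
    qed
    obtain t where t: "t \<ge> 1" "length p = 2 * t"
      using p(3) by (auto simp: repetitively_coloured_def)
    define q where "q = (if v \<in> set (take t p) then p else rev p)"
    have "p = take t p @ drop t p" by simp
    then have "v \<in> set (take t p) \<or> v \<in> set (drop t p)"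
      using \<open>v \<in> set p\<close> by (metis Un_iff set_append)
    then have "v \<in> set (take t q)"
      using t(2) by (auto simp: q_def take_rev)
    then have q: "vpath q G" "set q \<subseteq> S" "length q = 2 * t" "v \<in> set (take t q)"
        "repetitively_coloured \<phi> q"
      using p t vpath_rev[OF assms(1)] repetitively_coloured_rev by (auto simp: q_def)
    \<comment> \<open>The vertices of a path are distinct, so only finitely many half lengths can
      occur inside \<open>S\<close>.\<close>
    have "length q \<le> card S"
      using q(1,2) assms(2) by (metis card_mono distinct_card vpath_def)
    moreover obtain s where s: "t = Suc s"
      using t(1) by (cases t) auto
    ultimately have "s < card S" "q \<in> half_paths G S v (Suc s)"
      using q by (auto simp: half_paths_def)
    moreover have "\<forall>i<Suc s. \<phi> (q ! i) = \<phi> (q ! (Suc s + i))"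
    proof -
      \<comment> \<open>The half length in \<open>repetitively_coloured\<close> is existentially
        quantified; the length of \<open>q\<close> determines it.\<close>
      obtain t' where "length q = 2 * t'" "\<forall>i<t'. \<phi> (q ! i) = \<phi> (q ! (t' + i))"
        using q(5) by (auto simp: repetitively_coloured_def)
      moreover from this have "t' = Suc s"
        using q(3) s by simp
      ultimately show ?thesis by simp
    qed
    ultimately show ?thesis
      using \<phi> by blast
  qed simp
qed

section \<open>Deleting vertices and the main induction\<close>

lemma card_colourings_on_Diff:
  fixes \<beta> :: real
  assumes "finite A" "0 \<le> \<beta>" "A \<subseteq> S"
    and "\<And>T v. T \<subseteq> S \<Longrightarrow> v \<in> T \<Longrightarrow>
      \<beta> * real (card (colourings_on G L (T - {v}))) \<le> real (card (colourings_on G L T))"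
  shows "\<beta> ^ card A * real (card (colourings_on G L (S - A))) \<le> real (card (colourings_on G L S))"
  using assms(1,3)
proof (induction A rule: finite_induct)
  case (insert a A)
  \<comment> \<open>The vertices of the set are deleted one at a time, each for a factor
    \<open>\<beta>\<close>; hence the hypothesis speaks of all intermediate sets
    \<open>T\<close>.\<close>
  have "S - insert a A = S - A - {a}" by auto
  then have "\<beta> * real (card (colourings_on G L (S - insert a A)))
      \<le> real (card (colourings_on G L (S - A)))"
    using assms(4)[of "S - A" a] insert by auto
  then have "\<beta> ^ card A * (\<beta> * real (card (colourings_on G L (S - insert a A))))
      \<le> \<beta> ^ card A * real (card (colourings_on G L (S - A)))"
    using assms(2) by (intro mult_left_mono) auto
  then show ?case
    using insert by (simp add: mult_ac)
qed simp

text \<open>The numerical input is isolated in \<open>bound\<close>. It covers all partial sums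
  because half lengths are cut off at \<open>card S\<close>, which varies during the
  induction.\<close>

lemma card_colourings_on_delete:
  fixes \<beta> :: real
  assumes G: "graph G" and deg: "\<And>u. u \<in> verts G \<Longrightarrow> out_degree G u \<le> D"
    and L: "list_assignment G c L" and "0 < \<beta>"
    and bound: "\<And>N. \<beta> + real D * (\<Sum>s<N. real (Suc s) * (real (D - 1) ^ 2 / \<beta>) ^ s) \<le> real c"
    and "S \<subseteq> verts G" "v \<in> S"
  shows "\<beta> * real (card (colourings_on G L (S - {v}))) \<le> real (card (colourings_on G L S))"
proof -
  interpret graph G by fact
  have finL: "finite (L u)" and cL: "card (L u) = c" if "u \<in> verts G" for u
    using L that by (auto simp: list_assignment_def)
  have "finite S"
    using \<open>S \<subseteq> verts G\<close> finite_verts by (rule finite_subset)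
  then show ?thesis
    using \<open>S \<subseteq> verts G\<close> \<open>v \<in> S\<close>
  proof (induction S arbitrary: v rule: finite_psubset_induct)
    case (psubset S)
    define K where "K = real (card (colourings_on G L (S - {v})))"
    define B where "B s p = {\<phi> \<in> extensions G L S v. \<forall>i<Suc s. \<phi> (p ! i) = \<phi> (p ! (Suc s + i))}"
      for s and p :: "'a list"
    have finS: "\<And>u. u \<in> S \<Longrightarrow> finite (L u)"
      using finL psubset.prems by auto
    \<comment> \<open>The half containing \<open>v\<close> has \<open>s + 1\<close> vertices, but
      \<open>K\<close> counts colourings with \<open>v\<close> already deleted, so only
      \<open>s\<close> factors \<open>\<beta>\<close> are gained.\<close>
    have cB: "real (card (B s p)) \<le> K / \<beta> ^ s" if "p \<in> half_paths G S v (Suc s)" for s p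
    proof -
      let ?A = "set (take (Suc s) p)"
      have p: "vpath p G" "set p \<subseteq> S" "length p = 2 * Suc s" "v \<in> ?A"
        using that by (auto simp: half_paths_def)
      have A: "?A \<subseteq> S"
        using p(2) set_take_subset by fastforce
      have "distinct (take (Suc s) p)"
        using p(1) by (auto simp: vpath_def)
      then have "card ?A = Suc s"
        using p(3) by (simp add: distinct_card)
      then have cA: "card (?A - {v}) = s"
        using p(4) by simp
      \<comment> \<open>The induction hypothesis applies to every subset of \<open>S - {v}\<close>,
        as these are proper subsets of \<open>S\<close>.\<close>
      have "\<beta> ^ card (?A - {v}) * real (card (colourings_on G L (S - {v} - (?A - {v}))))
        \<le> real (card (colourings_on G L (S - {v})))"
        using \<open>0 < \<beta>\<close> A psubset.prems
        by (intro card_colourings_on_Diff psubset.IH) auto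
      moreover have "S - {v} - (?A - {v}) = S - ?A"
        using p(4) by auto
      ultimately have "\<beta> ^ s * real (card (colourings_on G L (S - ?A))) \<le> K"
        unfolding cA K_def by simp
      moreover have "card (B s p) \<le> card (colourings_on G L (S - ?A))"
        unfolding B_def using card_repetitive_extensions_le[OF psubset.hyps finS p] .
      ultimately have "\<beta> ^ s * real (card (B s p)) \<le> K"
        using \<open>0 < \<beta>\<close> by (smt (verit) mult_left_mono of_nat_mono zero_le_power)
      then show ?thesis
        using \<open>0 < \<beta>\<close> by (simp add: pos_le_divide_eq mult.commute)
    qed
    have K: "0 \<le> K" by (simp add: K_def)
    \<comment> \<open>This brings the number of paths times the cost \<open>K / \<beta> ^ s\<close>
      of each into the shape of the summands in \<open>bound\<close>.\<close>
    have ineq: "real (Suc s * (D * (D - 1) ^ (2 * s))) * (K / \<beta> ^ s)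
        = real D * (real (Suc s) * (real (D - 1) ^ 2 / \<beta>) ^ s) * K" for s
      unfolding of_nat_mult of_nat_power power_divide power_mult
      by (simp only: times_divide_eq_left times_divide_eq_right mult_ac)
    have fins: "finite (half_paths G S v t)" for t
      by (intro finite_half_paths finite_verts)
    have finB: "finite (B s p)" for s p
      unfolding B_def using finite_extensions[where L = L, OF psubset.hyps finS]
      by (rule rev_finite_subset) auto
    have finC: "finite (colourings_on G L S)"
      by (intro finite_colourings_on psubset.hyps finS)
    \<comment> \<open>All \<open>c * K\<close> extensions are counted: the good ones exactly, the
      bad ones by a union bound over half lengths and paths.\<close>
    have "real c * K = real (card (extensions G L S v))"
      unfolding K_def using card_extensions[OF psubset.prems(2), of G L] cL psubset.prems by auto
    also have "\<dots> \<le> real (card (colourings_on G L S \<union>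
        (\<Union>s<card S. \<Union>p\<in>half_paths G S v (Suc s). B s p)))"
      using extensions_subset[OF G psubset.hyps psubset.prems(2), of L] finC finB fins
      unfolding B_def[symmetric] by (intro of_nat_mono card_mono) auto
    also have "\<dots> \<le> real (card (colourings_on G L S) +
        card (\<Union>s<card S. \<Union>p\<in>half_paths G S v (Suc s). B s p))"
      by (intro of_nat_mono card_Un_le)
    also have "\<dots> \<le> real (card (colourings_on G L S) +
        (\<Sum>s<card S. \<Sum>p\<in>half_paths G S v (Suc s). card (B s p)))"
      by (intro of_nat_mono add_left_mono order_trans[OF card_UN_le sum_mono] card_UN_le fins) simp
    also have "\<dots> = real (card (colourings_on G L S)) +
        (\<Sum>s<card S. \<Sum>p\<in>half_paths G S v (Suc s). real (card (B s p)))"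
      by simp
    also have "\<dots> \<le> real (card (colourings_on G L S)) +
        (\<Sum>s<card S. \<Sum>p\<in>half_paths G S v (Suc s). K / \<beta> ^ s)"
      by (intro add_left_mono sum_mono cB)
    also have "\<dots> = real (card (colourings_on G L S)) +
        (\<Sum>s<card S. real (card (half_paths G S v (Suc s))) * (K / \<beta> ^ s))"
      by simp
    also have "\<dots> \<le> real (card (colourings_on G L S)) +
        (\<Sum>s<card S. real (Suc s * (D * (D - 1) ^ (2 * s))) * (K / \<beta> ^ s))"
      using K \<open>0 < \<beta>\<close>
      by (intro add_left_mono sum_mono mult_right_mono of_nat_mono card_half_paths_le[OF G deg]) auto
    also have "\<dots> = real (card (colourings_on G L S)) +
        real D * (\<Sum>s<card S. real (Suc s) * (real (D - 1) ^ 2 / \<beta>) ^ s) * K"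
      by (simp only: ineq sum_distrib_left sum_distrib_right)
    finally have "real c * K \<le> real (card (colourings_on G L S)) +
        real D * (\<Sum>s<card S. real (Suc s) * (real (D - 1) ^ 2 / \<beta>) ^ s) * K" .
    \<comment> \<open>Taking \<open>bound\<close> at \<open>N = card S\<close>, the sum of the bad
      extensions cancels and \<open>\<beta> * K\<close> is left for the good ones.\<close>
    moreover have "(\<beta> + real D * (\<Sum>s<card S. real (Suc s) * (real (D - 1) ^ 2 / \<beta>) ^ s)) * K
        \<le> real c * K"
      using K by (intro mult_right_mono bound)
    ultimately show ?case
      unfolding K_def[symmetric] by (simp add: distrib_right)
  qed
qed

lemma card_nonrepetitive_list_colourings_ge:
  fixes \<beta> :: real
  assumes G: "graph G" and "\<And>u. u \<in> verts G \<Longrightarrow> out_degree G u \<le> D"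
    and "list_assignment G c L" and "0 < \<beta>"
    and "\<And>N. \<beta> + real D * (\<Sum>s<N. real (Suc s) * (real (D - 1) ^ 2 / \<beta>) ^ s) \<le> real c"
  shows "\<beta> ^ card (verts G) \<le> real (card (nonrepetitive_list_colourings G L))"
proof -
  interpret graph G by fact
  \<comment> \<open>Deleting all vertices ends at the empty set, which has exactly one
    colouring.\<close>
  have "\<beta> ^ card (verts G) * real (card (colourings_on G L (verts G - verts G)))
      \<le> real (card (colourings_on G L (verts G)))"
    using \<open>0 < \<beta>\<close>
    by (intro card_colourings_on_Diff card_colourings_on_delete[OF assms]) auto
  then show ?thesis
    by (simp add: colourings_on_verts colourings_on_empty)
qed

section \<open>The number of colours\<close>

text \<open>The full series is the derivative of the geometric series, with sum
  \<open>1 / (1 - x)\<^sup>2\<close>; the closed form of the partial sums shows that they stay below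
  it.\<close>

lemma sum_Suc_power_le:
  fixes x :: real
  assumes "0 \<le> x" "x < 1"
  shows "(\<Sum>s<N. real (Suc s) * x ^ s) \<le> 1 / (1 - x)\<^sup>2"
proof -
  have "(1 - x)\<^sup>2 * (\<Sum>s<N. real (Suc s) * x ^ s)
      = 1 - real N * x ^ N * (1 - x) - x ^ N"
  proof (induction N)
    case (Suc N)
    then show ?case
      by (simp add: distrib_left) (simp add: algebra_simps power2_eq_square)
  qed simp
  also have "\<dots> \<le> 1"
  proof -
    have "0 \<le> real N * x ^ N * (1 - x)" "0 \<le> x ^ N"
      using assms by auto
    then show ?thesis by linarith
  qed
  finally show ?thesis
    using assms by (simp add: pos_le_divide_eq mult.commute)
qed

lemma out_degree_le_max_degree:
  assumes "finite (verts G)" "u \<in> verts G"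
  shows "out_degree G u \<le> max_degree G"
  unfolding max_degree_def using assms by (intro Max_ge) auto

text \<open>The choice of \<open>\<beta>\<close> makes the ratio
  \<open>1 / (1 + \<epsilon>)\<close>, so the series is at most
  \<open>((1 + \<epsilon>) / \<epsilon>)\<^sup>2\<close>; the choice of \<open>\<epsilon>\<close>
  turns \<open>D / \<epsilon>\<^sup>2\<close> into the coefficient in the definition of
  \<open>c\<close>. With \<open>2 \<le> D\<close> the factor \<open>(D - 1)\<^sup>2\<close> can be
  cancelled.\<close>

lemma colour_bound:
  fixes \<beta> \<epsilon> :: real
  assumes "2 \<le> D" and \<epsilon>: "\<epsilon> = 2 powr (1/3) * real D powr (-1/3)"
    and \<beta>: "\<beta> = (1 + \<epsilon>) * (real D - 1)\<^sup>2"
  shows "\<beta> + real D * (\<Sum>s<N. real (Suc s) * (real (D - 1) ^ 2 / \<beta>) ^ s)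
    \<le> \<beta> + 2 powr (-2/3) * real D powr (5/3) * (1 + \<epsilon>)\<^sup>2"
proof -
  have "0 < \<epsilon>" using assms by simp
  have x: "real (D - 1) ^ 2 / \<beta> = 1 / (1 + \<epsilon>)"
  proof -
    have "(real D - 1)\<^sup>2 \<noteq> 0"
      using assms(1) by simp
    then show ?thesis
      using assms(1) by (simp add: \<beta> of_nat_diff)
  qed
  have "1 - 1 / (1 + \<epsilon>) = \<epsilon> / (1 + \<epsilon>)"
    using \<open>0 < \<epsilon>\<close> by (simp add: field_simps)
  then have "(\<Sum>s<N. real (Suc s) * (1 / (1 + \<epsilon>)) ^ s) \<le> 1 / (\<epsilon> / (1 + \<epsilon>))\<^sup>2"
    using sum_Suc_power_le[of "1 / (1 + \<epsilon>)" N] \<open>0 < \<epsilon>\<close> by simp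
  then have "real D * (\<Sum>s<N. real (Suc s) * (real (D - 1) ^ 2 / \<beta>) ^ s)
      \<le> real D * (1 / (\<epsilon> / (1 + \<epsilon>))\<^sup>2)"
    unfolding x by (intro mult_left_mono) auto
  also have "\<dots> = real D / \<epsilon>\<^sup>2 * (1 + \<epsilon>)\<^sup>2"
    by (simp add: power_divide)
  also have "real D / \<epsilon>\<^sup>2 = 2 powr (-2/3) * real D powr (5/3)"
  proof -
    have "\<epsilon>\<^sup>2 = 2 powr (2/3) * real D powr (-2/3)"
      unfolding \<epsilon> power_mult_distrib using assms(1) by (simp add: powr_power)
    moreover have "real D powr (5/3) * real D powr (-2/3) = real D"
      using assms(1) by (simp flip: powr_add)
    moreover have "2 powr (-2/3) * 2 powr (2/3) = (1::real)"
      by (simp flip: powr_add)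
    moreover have "2 powr (-2/3) * real D powr (5/3) * (2 powr (2/3) * real D powr (-2/3))
        = (2 powr (-2/3) * 2 powr (2/3)) * (real D powr (5/3) * real D powr (-2/3))"
      by (simp only: mult_ac)
    ultimately have "2 powr (-2/3) * real D powr (5/3) * \<epsilon>\<^sup>2 = real D"
      by (simp only: mult_1)
    then show ?thesis
      using \<open>0 < \<epsilon>\<close> by (simp add: nonzero_divide_eq_eq)
  qed
  finally show ?thesis by simp
qed

theorem theorem6:
  fixes G :: "('a, 'b) pre_digraph" and \<Delta> c :: nat and \<beta> :: real
  assumes "graph G"
    and "\<Delta> \<ge> 1"
    and "max_degree G = \<Delta>"
    and "\<beta> = (1 + 2 powr (1/3) * real \<Delta> powr (-1/3)) * (real \<Delta> - 1)^2"
    and "c = nat \<lceil>\<beta> + 2 powr (-2/3) * real \<Delta> powr (5/3) * (1 + 2 powr (1/3) * real \<Delta> powr (-1/3))^2\<rceil>"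
  shows "nonrepetitively_choosable TYPE('c) G c \<and>
    (\<forall>L :: 'a \<Rightarrow> 'c set. list_assignment G c L \<longrightarrow>
       real (card (nonrepetitive_list_colourings G L)) \<ge> \<beta> ^ card (verts G))"
proof -
  interpret graph G by fact
  define \<epsilon> where "\<epsilon> = 2 powr (1/3) * real \<Delta> powr (-1/3)"
  have deg: "out_degree G u \<le> \<Delta>" if "u \<in> verts G" for u
    using out_degree_le_max_degree[OF finite_verts that] assms(3) by simp
  have \<beta>: "\<beta> = (1 + \<epsilon>) * (real \<Delta> - 1)\<^sup>2"
    using assms(4) by (simp add: \<epsilon>_def)
  have c: "\<beta> + 2 powr (-2/3) * real \<Delta> powr (5/3) * (1 + \<epsilon>)\<^sup>2 \<le> real c"
    unfolding assms(5) \<epsilon>_def by linarith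
  \<comment> \<open>For \<open>\<Delta> = 1\<close> we have \<open>\<beta> = 0\<close> and cannot divide by it; there \<open>c \<ge> 2\<close> and \<open>\<gamma> = 1\<close> works.\<close>
  obtain \<gamma> where \<gamma>: "0 < \<gamma>" "0 \<le> \<beta>" "\<beta> \<le> \<gamma>"
    "\<And>N. \<gamma> + real \<Delta> * (\<Sum>s<N. real (Suc s) * (real (\<Delta> - 1) ^ 2 / \<gamma>) ^ s) \<le> real c"
  proof (cases "\<Delta> = 1")
    case True
    \<comment> \<open>Strictly more than 1 suffices, since \<open>c\<close> is an integer at least
      as large.\<close>
    have "1 < 2 powr (-2/3) * (1 + 2 powr (1/3) :: real)\<^sup>2"
    proof -
      have "2 powr (-2/3) * (2 powr (1/3))\<^sup>2 = (1::real)"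
        by (simp add: powr_power flip: powr_add)
      moreover have "2 powr (-2/3) * (2 powr (1/3))\<^sup>2 < 2 powr (-2/3) * (1 + 2 powr (1/3) :: real)\<^sup>2"
        by (intro mult_strict_left_mono power_strict_mono) auto
      ultimately show ?thesis by simp
    qed
    then have "2 \<le> c"
      using c True by (simp add: \<beta> \<epsilon>_def)
    \<comment> \<open>The ratio is 0 here, so only the term \<open>s = 0\<close> with
      \<open>0 ^ 0 = 1\<close> can contribute, and \<open>1 + 1 \<le> c\<close> is all that is
      required.\<close>
    moreover have "(\<Sum>s<N. real (Suc s) * 0 ^ s) \<le> 1" for N
      using sum_Suc_power_le[of 0 N] by simp
    ultimately show ?thesis
      using that[of 1] True by (force simp: \<beta> intro: order_trans[of _ 2])
  next
    case False
    then have "2 \<le> \<Delta>" using assms(2) by simp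
    then have "0 < \<beta>"
      unfolding \<beta> \<epsilon>_def by (intro mult_pos_pos) (auto intro: add_pos_nonneg)
    then show ?thesis
      using that[of \<beta>] order_trans[OF colour_bound[OF \<open>2 \<le> \<Delta>\<close> \<epsilon>_def \<beta>] c] by simp
  qed
  have *: "\<gamma> ^ card (verts G) \<le> real (card (nonrepetitive_list_colourings G L))"
    if "list_assignment G c L" for L :: "'a \<Rightarrow> 'c set"
    by (intro card_nonrepetitive_list_colourings_ge[OF assms(1) deg that \<gamma>(1) \<gamma>(4)])
  have "\<beta> ^ card (verts G) \<le> \<gamma> ^ card (verts G)"
    using \<gamma> by (intro power_mono)
  \<comment> \<open>Existence is drawn from the power of \<open>\<gamma>\<close>, which is positive;
    that of \<open>\<beta>\<close> may be 0.\<close>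
  moreover have "nonrepetitive_list_colourings G L \<noteq> {}" if "list_assignment G c L"
    for L :: "'a \<Rightarrow> 'c set"
    using *[OF that] zero_less_power[OF \<gamma>(1), of "card (verts G)"]
    by (auto simp del: zero_less_power)
  ultimately show ?thesis
    using * by (force simp: nonrepetitively_choosable_def)
qed

end
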